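(* Let $n\ge 2$ be an integer, let $k_1,\dots,k_{n-1}\ge 1$ and $s_1,\dots,s_{n-1}$ be integers, let $c_{u_1u_2\dots u_{n-1}}$ ($1\le u_i\le k_i$ for $i=1,\dots,n-1$) be complex numbers, and let $\Psi:\mathbb{Z}^{n-1}\to\mathbb{C}$ be a given function. Consider the linear partial difference equation $$U_{e_{1}+s_{1},\,e_{2}+s_{2},\dots,\,e_{n-1}+s_{n-1},\,e_{n}+1}=\sum_{u_{1}=1}^{k_{1}}\sum_{u_{2}=1}^{k_{2}}\cdots\sum_{u_{n-1}=1}^{k_{n-1}}c_{u_{1}u_{2}\dots u_{n-1}}\,U_{e_{1}+u_{1}-1,\,e_{2}+u_{2}-1,\dots,\,e_{n-1}+u_{n-1}-1,\,e_{n}}$$ for all $e_1,\dots,e_{n-1}\in\mathbb{Z}$ and $e_n\in\mathbb{N}\cup\{0\}$, for an unknown function $U:\mathbb{Z}^{n-1}\times(\mathbb{N}\cup\{0\})\to\mathbb{C}$, with the initial condition $U_{e_{1},\dots,e_{n-1},0}=\Psi(e_{1},\dots,e_{n-1})$ for all $e_1,\dots,e_{n-1}\in\mathbb{Z}$. Then its solution is given, for all $e_1,\dots,e_{n-1}\in\mathbb{Z}$ and $e_n\in\mathbb{N}\cup\{0\}$, by $$U_{e_{1},e_{2},\dots,e_{n}}=\sum_{(r_{u_{1}\dots u_{n-1}})\in I}\binom{e_n}{r_{11\dots1},r_{11\dots2},\dots,r_{11\dots k_{n-1}},\dots,r_{k_{1}k_{2}\dots k_{n-1}}}\,\Psi(e_{1}-a_{1},\dots,e_{n-1}-a_{n-1})\prod_{u_1=1}^{k_1}\cdots\prod_{u_{n-1}=1}^{k_{n-1}}c_{u_{1}u_{2}\dots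 u_{n-1}}^{\,r_{u_{1}u_{2}\dots u_{n-1}}},$$ where $I$ is the set of all families of integers $(r_{u_1\dots u_{n-1}})_{1\le u_i\le k_i}$ with $0\le r_{u_1\dots u_{n-1}}\le e_n$ for all indices and $\sum_{u_1=1}^{k_1}\cdots\sum_{u_{n-1}=1}^{k_{n-1}}r_{u_1\dots u_{n-1}}=e_n$, and, for each such family and each $i=1,\dots,n-1$, $$a_i=(s_i+1)e_n-\sum_{u_1=1}^{k_1}\cdots\sum_{u_{n-1}=1}^{k_{n-1}}u_i\,r_{u_1u_2\dots u_{n-1}}.$$
   Context: $\mathbb{N}=\{1,2,\dots\}$. The symbol $\binom{N}{r_{11\dots1},\dots,r_{k_1\dots k_{n-1}}}=\frac{N!}{\prod r_{u_1\dots u_{n-1}}!}$ (product over all index tuples, for nonnegative integers $r_{u_1\dots u_{n-1}}$ summing to $N$) is the multinomial coefficient. The convention $0^0=1$ is used in powers of coefficients. *)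

theory Defs
  imports Complex_Main "HOL-Library.FuncSet"
begin

text \<open>
  A tuple with entries indexed by 1, ..., d is an extensional function on \<open>{1..d}\<close>
  (its value is \<open>undefined\<close> outside \<open>{1..d}\<close>), so that equality of tuples is equality of
  functions. The dimension d plays the role of n - 1.
\<close>

definition int_lattice :: "nat \<Rightarrow> (nat \<Rightarrow> int) set" where
  "int_lattice d = {1..d} \<rightarrow>\<^sub>E UNIV"

definition index_tuples :: "nat \<Rightarrow> (nat \<Rightarrow> nat) \<Rightarrow> (nat \<Rightarrow> nat) set" where
  "index_tuples d k = (\<Pi>\<^sub>E i\<in>{1..d}. {1..k i})"

text \<open>
  Families \<open>r\<close> of integers between 0 and \<open>N\<close> with total \<open>N\<close>. They are natural-number valued,
  which loses nothing as the entries are nonnegative, and extensional, so that each family is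
  counted exactly once when summing over this set.
\<close>

definition exponent_families :: "'a set \<Rightarrow> nat \<Rightarrow> ('a \<Rightarrow> nat) set" where
  "exponent_families J N = {r \<in> J \<rightarrow>\<^sub>E {0..N}. (\<Sum>u\<in>J. r u) = N}"

definition multinomial :: "nat \<Rightarrow> 'a set \<Rightarrow> ('a \<Rightarrow> nat) \<Rightarrow> complex" where
  "multinomial N J r = fact N / (\<Prod>u\<in>J. fact (r u))"

definition lattice_shift ::
  "nat \<Rightarrow> (nat \<Rightarrow> nat) \<Rightarrow> (nat \<Rightarrow> int) \<Rightarrow> nat \<Rightarrow> ((nat \<Rightarrow> nat) \<Rightarrow> nat) \<Rightarrow> nat \<Rightarrow> int" where
  "lattice_shift d k s N r i =
     (s i + 1) * int N - (\<Sum>u\<in>index_tuples d k. int (u i) * int (r u))"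

end

theory Submission
  imports Defs
begin

text \<open>
  Write \<open>J\<close> for the set of index tuples. One step of the equation moves a solution value by a
  choice of \<open>u \<in> J\<close>, with weight \<open>c u\<close> and a translation of the lattice that depends on \<open>u\<close> only.
  Iterating \<open>m\<close> times gives a sum over words of length \<open>m\<close> in \<open>J\<close>; since translations commute,
  a word contributes only through the number \<open>r u\<close> of occurrences of each letter, and the
  multinomial coefficient counts the words with given numbers of occurrences.

  The proof replaces words by the generalised Pascal rule: sorting words by one letter
  turns a weighted sum over families of total \<open>m + 1\<close> into sums over families of total \<open>m\<close>, as
  stated in \<open>sum_multinomial_Suc\<close> for an arbitrary weight. Together with the effect of one
  extra letter on the displacement (\<open>lattice_shift_increment\<close>), this shows that the explicit
  formula satisfies the equation (\<open>explicit_solution_step\<close>). Conversely the equation determines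
  each time layer from the preceding one, because translation by \<open>s\<close> is a bijection of the
  lattice, so a solution is unique by induction on time.
\<close>

section \<open>A Pascal rule for multinomial sums\<close>

lemma finite_exponent_families: "finite J \<Longrightarrow> finite (exponent_families J m)"
  unfolding exponent_families_def
  by (rule finite_subset[of _ "J \<rightarrow>\<^sub>E {0..m}"]) (auto intro: finite_PiE)

text \<open>The upper bound on the entries of a family follows from the total, which makes membership
  easy to check after changing one entry.\<close>

lemma exponent_families_iff:
  assumes "finite J"
  shows "r \<in> exponent_families J m \<longleftrightarrow> r \<in> extensional J \<and> sum r J = m"
  using assms by (auto simp: exponent_families_def PiE_iff intro: member_le_sum)

lemma sum_increment:
  fixes r :: "'a \<Rightarrow> nat"
  assumes "finite J" "u \<in> J"
  shows "sum (r(u := Suc (r u))) J = Suc (sum r J)"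
proof -
  have "sum (r(u := Suc (r u))) (J - {u}) = sum r (J - {u})"
    by (intro sum.cong) auto
  then show ?thesis
    using assms by (simp add: sum.remove)
qed

lemma prod_fun_upd:
  fixes f :: "'a \<Rightarrow> nat \<Rightarrow> 'b::comm_monoid_mult"
  assumes "finite J" "u \<in> J"
  shows "(\<Prod>v\<in>J. f v ((r(u := x)) v)) = f u x * (\<Prod>v\<in>J - {u}. f v (r v))"
proof -
  have "(\<Prod>v\<in>J - {u}. f v ((r(u := x)) v)) = (\<Prod>v\<in>J - {u}. f v (r v))"
    by (intro prod.cong) auto
  then show ?thesis
    using assms by (simp add: prod.remove)
qed

lemma bij_betw_increment:
  assumes "finite J" "u \<in> J"
  shows "bij_betw (\<lambda>r. r(u := Suc (r u))) (exponent_families J m)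
           {r \<in> exponent_families J (Suc m). r u \<noteq> 0}"
proof (rule bij_betw_byWitness[where f' = "\<lambda>r. r(u := r u - 1)"])
  show "(\<lambda>r. r(u := Suc (r u))) ` exponent_families J m
          \<subseteq> {r \<in> exponent_families J (Suc m). r u \<noteq> 0}"
    using assms sum_increment[OF assms]
    by (auto simp: exponent_families_iff extensional_def)
  show "(\<lambda>r. r(u := r u - 1)) ` {r \<in> exponent_families J (Suc m). r u \<noteq> 0}
          \<subseteq> exponent_families J m"
  proof (rule image_subsetI)
    fix r assume "r \<in> {r \<in> exponent_families J (Suc m). r u \<noteq> 0}"
    then have r: "r \<in> exponent_families J (Suc m)" "r u \<noteq> 0"
      by auto
    have "sum r J = Suc (sum (r(u := r u - 1)) J)"
      using sum_increment[OF assms, of "r(u := r u - 1)"] r(2) by simp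
    then show "r(u := r u - 1) \<in> exponent_families J m"
      using r assms by (auto simp: exponent_families_iff extensional_def)
  qed
qed auto

text \<open>In terms of words: among the words with \<open>r u + 1\<close> occurrences of \<open>u\<close> and \<open>r v\<close> of every
  other \<open>v\<close>, the fraction that starts with \<open>u\<close> is \<open>(r u + 1) / (m + 1)\<close>.\<close>

lemma multinomial_increment:
  assumes "finite J" "u \<in> J"
  shows "multinomial (Suc m) J (r(u := Suc (r u))) * of_nat (Suc (r u))
           = of_nat (Suc m) * multinomial m J r"
proof -
  define P :: complex where "P = (\<Prod>v\<in>J - {u}. fact (r v))"
  have "P \<noteq> 0"
    using assms by (simp add: P_def)
  have new: "(\<Prod>v\<in>J. fact ((r(u := Suc (r u))) v)) = fact (Suc (r u)) * P"
    unfolding P_def by (rule prod_fun_upd[OF assms])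
  have old: "(\<Prod>v\<in>J. fact (r v)) = fact (r u) * P"
    unfolding P_def using assms by (simp add: prod.remove)
  have cancel: "a * b / (x * f * P) * x = a * (b / (f * P))" if "x \<noteq> 0" for a b x f :: complex
    using that by simp
  show ?thesis
    unfolding multinomial_def new old fact_Suc
    by (rule cancel) (simp del: of_nat_Suc)
qed

text \<open>Because the entries of a family of total \<open>m + 1\<close> sum to \<open>m + 1\<close>, its weight can be distributed
  over the letters \<open>u\<close> in proportion to \<open>r u\<close>; the part assigned to \<open>u\<close> comes from the
  families of total \<open>m\<close> by adding one to the entry at \<open>u\<close>.\<close>

lemma sum_multinomial_Suc:
  fixes F :: "('a \<Rightarrow> nat) \<Rightarrow> complex"
  assumes J: "finite J"
  shows "(\<Sum>r\<in>exponent_families J (Suc m). multinomial (Suc m) J r * F r)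
           = (\<Sum>u\<in>J. \<Sum>r\<in>exponent_families J m. multinomial m J r * F (r(u := Suc (r u))))"
proof -
  let ?E = "exponent_families J (Suc m)"
  let ?w = "\<lambda>r. multinomial (Suc m) J r * F r"
  have layer: "(\<Sum>r\<in>?E. of_nat (r u) * ?w r)
      = of_nat (Suc m) * (\<Sum>r\<in>exponent_families J m. multinomial m J r * F (r(u := Suc (r u))))"
    if u: "u \<in> J" for u
  proof -
    have "(\<Sum>r\<in>?E. of_nat (r u) * ?w r) = (\<Sum>r\<in>{r \<in> ?E. r u \<noteq> 0}. of_nat (r u) * ?w r)"
      by (rule sum.mono_neutral_right) (auto simp: finite_exponent_families J)
    also have "\<dots> = (\<Sum>r\<in>exponent_families J m.
        of_nat (Suc (r u)) * ?w (r(u := Suc (r u))))"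
      by (subst sum.reindex_bij_betw[OF bij_betw_increment[OF J u], symmetric]) simp
    also have "\<dots> = (\<Sum>r\<in>exponent_families J m.
        of_nat (Suc m) * (multinomial m J r * F (r(u := Suc (r u)))))"
    proof (rule sum.cong[OF refl])
      fix r
      show "of_nat (Suc (r u)) * ?w (r(u := Suc (r u)))
          = of_nat (Suc m) * (multinomial m J r * F (r(u := Suc (r u))))"
        using arg_cong[OF multinomial_increment[OF J u, of m r],
            of "\<lambda>x. x * F (r(u := Suc (r u)))"]
        by (simp only: mult_ac)
    qed
    finally show ?thesis
      by (simp only: sum_distrib_left)
  qed
  have "of_nat (Suc m) * (\<Sum>r\<in>?E. ?w r) = (\<Sum>r\<in>?E. \<Sum>u\<in>J. of_nat (r u) * ?w r)"
    unfolding sum_distrib_left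
  proof (rule sum.cong[OF refl])
    fix r assume "r \<in> ?E"
    then have "of_nat (Suc m) = (\<Sum>u\<in>J. of_nat (r u) :: complex)"
      by (simp add: exponent_families_iff J flip: of_nat_sum)
    then show "of_nat (Suc m) * ?w r = (\<Sum>u\<in>J. of_nat (r u) * ?w r)"
      by (simp only: sum_distrib_right)
  qed
  also have "\<dots> = (\<Sum>u\<in>J. \<Sum>r\<in>?E. of_nat (r u) * ?w r)"
    by (rule sum.swap)
  also have "\<dots> = of_nat (Suc m) *
      (\<Sum>u\<in>J. \<Sum>r\<in>exponent_families J m. multinomial m J r * F (r(u := Suc (r u))))"
    by (simp only: layer sum_distrib_left cong: sum.cong)
  finally show ?thesis
    by (simp del: of_nat_Suc)
qed

section \<open>The explicit solution\<close>

lemma finite_index_tuples: "finite (index_tuples d k)"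
  unfolding index_tuples_def by (intro finite_PiE) auto

lemma restrict_in_int_lattice: "(\<lambda>i\<in>{1..d}. f i) \<in> int_lattice d"
  by (simp add: int_lattice_def)

lemma restrict_int_lattice: "e \<in> int_lattice d \<Longrightarrow> (\<lambda>i\<in>{1..d}. e i) = e"
  unfolding int_lattice_def by (rule PiE_restrict)

text \<open>The displacement caused by one additional letter \<open>u\<close>; it does not depend on the letters used
  before, so displacements along a word add up.\<close>

lemma lattice_shift_increment:
  assumes u: "u \<in> index_tuples d k"
  shows "lattice_shift d k s (Suc m) (r(u := Suc (r u))) i
           = lattice_shift d k s m r i + s i + 1 - int (u i)"
proof -
  let ?J = "index_tuples d k"
  have "(\<Sum>v\<in>?J. int (v i) * int ((r(u := Suc (r u))) v))
      = (\<Sum>v\<in>?J. int (v i) * int (r v) + (if v = u then int (u i) else 0))"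
    by (intro sum.cong) (auto simp: algebra_simps)
  also have "\<dots> = (\<Sum>v\<in>?J. int (v i) * int (r v)) + int (u i)"
    using u by (simp add: sum.distrib finite_index_tuples)
  finally show ?thesis
    unfolding lattice_shift_def by (simp add: algebra_simps)
qed

definition explicit_solution ::
  "nat \<Rightarrow> (nat \<Rightarrow> nat) \<Rightarrow> (nat \<Rightarrow> int) \<Rightarrow> ((nat \<Rightarrow> nat) \<Rightarrow> complex) \<Rightarrow>
    ((nat \<Rightarrow> int) \<Rightarrow> complex) \<Rightarrow> (nat \<Rightarrow> int) \<Rightarrow> nat \<Rightarrow> complex" where
  "explicit_solution d k s c \<Psi> e m =
     (\<Sum>r\<in>exponent_families (index_tuples d k) m.
        multinomial m (index_tuples d k) r *
        \<Psi> (\<lambda>i\<in>{1..d}. e i - lattice_shift d k s m r i) *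
        (\<Prod>u\<in>index_tuples d k. c u ^ r u))"

lemma explicit_solution_0:
  assumes "e \<in> int_lattice d"
  shows "explicit_solution d k s c \<Psi> e 0 = \<Psi> e"
proof -
  let ?J = "index_tuples d k"
  have "exponent_families ?J 0 = {\<lambda>u\<in>?J. 0}"
    by (auto simp: exponent_families_iff finite_index_tuples extensional_def fun_eq_iff)
  then show ?thesis
    using restrict_int_lattice[OF assms]
    by (simp add: explicit_solution_def multinomial_def lattice_shift_def)
qed

text \<open>The Pascal rule, applied to the product of the initial value and the coefficient monomial,
  splits off one letter \<open>u\<close>: the monomial releases a factor \<open>c u\<close>, and the argument of the initial
  value moves by the displacement of \<open>u\<close>, which is the one prescribed by the equation.\<close>

lemma explicit_solution_step:
  "explicit_solution d k s c \<Psi> (\<lambda>i\<in>{1..d}. e i + s i) (Suc m) =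
     (\<Sum>u\<in>index_tuples d k.
        c u * explicit_solution d k s c \<Psi> (\<lambda>i\<in>{1..d}. e i + int (u i) - 1) m)"
proof -
  let ?J = "index_tuples d k"
  define F where "F r = \<Psi> (\<lambda>i\<in>{1..d}. e i + s i - lattice_shift d k s (Suc m) r i) *
    (\<Prod>u\<in>?J. c u ^ r u)" for r
  have argument: "(\<lambda>i\<in>{1..d}. (\<lambda>i\<in>{1..d}. f i) i - g i) = (\<lambda>i\<in>{1..d}. f i - g i)"
    for f g :: "nat \<Rightarrow> int"
    by (rule restrict_ext) simp
  have split: "F (r(u := Suc (r u))) = c u *
      (\<Psi> (\<lambda>i\<in>{1..d}. e i + int (u i) - 1 - lattice_shift d k s m r i) * (\<Prod>v\<in>?J. c v ^ r v))"
    if u: "u \<in> ?J" for u r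
  proof -
    have "(\<Prod>v\<in>?J. c v ^ (r(u := Suc (r u))) v) = c u * (\<Prod>v\<in>?J. c v ^ r v)"
      using prod_fun_upd[OF finite_index_tuples u, of "\<lambda>v x. c v ^ x" r "Suc (r u)"] u
      by (simp add: prod.remove finite_index_tuples mult.assoc)
    moreover have "(\<lambda>i\<in>{1..d}. e i + s i - lattice_shift d k s (Suc m) (r(u := Suc (r u))) i)
        = (\<lambda>i\<in>{1..d}. e i + int (u i) - 1 - lattice_shift d k s m r i)"
      by (rule restrict_ext) (simp add: lattice_shift_increment[OF u])
    ultimately show ?thesis
      unfolding F_def by (simp only: mult_ac)
  qed
  have "explicit_solution d k s c \<Psi> (\<lambda>i\<in>{1..d}. e i + s i) (Suc m)
      = (\<Sum>r\<in>exponent_families ?J (Suc m). multinomial (Suc m) ?J r * F r)"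
    unfolding explicit_solution_def argument F_def by (simp only: mult.assoc)
  also have "\<dots> = (\<Sum>u\<in>?J. \<Sum>r\<in>exponent_families ?J m.
      multinomial m ?J r * F (r(u := Suc (r u))))"
    by (rule sum_multinomial_Suc[OF finite_index_tuples])
  also have "\<dots> = (\<Sum>u\<in>?J.
      c u * explicit_solution d k s c \<Psi> (\<lambda>i\<in>{1..d}. e i + int (u i) - 1) m)"
    unfolding explicit_solution_def argument sum_distrib_left
    by (intro sum.cong refl) (simp only: split mult_ac)
  finally show ?thesis .
qed

theorem theorem4p4:
  fixes n :: nat
    and k :: "nat \<Rightarrow> nat"
    and s :: "nat \<Rightarrow> int"
    and c :: "(nat \<Rightarrow> nat) \<Rightarrow> complex"
    and \<Psi> :: "(nat \<Rightarrow> int) \<Rightarrow> complex"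
    and U :: "(nat \<Rightarrow> int) \<Rightarrow> nat \<Rightarrow> complex"
  assumes "n \<ge> 2"
    and "\<And>i. i \<in> {1..n - 1} \<Longrightarrow> k i \<ge> 1"
  shows
    "((\<forall>e\<in>int_lattice (n - 1). \<forall>m.
         U (\<lambda>i\<in>{1..n - 1}. e i + s i) (m + 1) =
           (\<Sum>u\<in>index_tuples (n - 1) k.
              c u * U (\<lambda>i\<in>{1..n - 1}. e i + int (u i) - 1) m)) \<and>
      (\<forall>e\<in>int_lattice (n - 1). U e 0 = \<Psi> e))
     \<longleftrightarrow>
     (\<forall>e\<in>int_lattice (n - 1). \<forall>m.
        U e m =
          (\<Sum>r\<in>exponent_families (index_tuples (n - 1) k) m.
             multinomial m (index_tuples (n - 1) k) r *
             \<Psi> (\<lambda>i\<in>{1..n - 1}. e i - lattice_shift (n - 1) k s m r i) *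
             (\<Prod>u\<in>index_tuples (n - 1) k. c u ^ r u)))"
proof -
  define d where "d = n - 1"
  let ?J = "index_tuples d k"
  let ?V = "explicit_solution d k s c \<Psi>"
  have "((\<forall>e\<in>int_lattice d. \<forall>m.
           U (\<lambda>i\<in>{1..d}. e i + s i) (m + 1) =
             (\<Sum>u\<in>?J. c u * U (\<lambda>i\<in>{1..d}. e i + int (u i) - 1) m)) \<and>
         (\<forall>e\<in>int_lattice d. U e 0 = \<Psi> e))
      \<longleftrightarrow> (\<forall>e\<in>int_lattice d. \<forall>m. U e m = ?V e m)" (is "?solution \<longleftrightarrow> ?formula")
  proof
    assume sol: ?solution
    have "\<forall>e\<in>int_lattice d. U e m = ?V e m" for m
    proof (induction m)
      case 0
      show ?case
        using sol by (simp add: explicit_solution_0)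
    next
      case (Suc m)
      show ?case
      proof
        fix e assume e: "e \<in> int_lattice d"
        \<comment> \<open>The equation is stated at translated points, and every lattice point is one.\<close>
        define e' where "e' = (\<lambda>i\<in>{1..d}. e i - s i)"
        have e': "e' \<in> int_lattice d"
          unfolding e'_def by (rule restrict_in_int_lattice)
        have "(\<lambda>i\<in>{1..d}. e' i + s i) = (\<lambda>i\<in>{1..d}. e i)"
          by (rule restrict_ext) (simp add: e'_def)
        then have translated: "(\<lambda>i\<in>{1..d}. e' i + s i) = e"
          using restrict_int_lattice[OF e] by simp
        have "U (\<lambda>i\<in>{1..d}. e' i + s i) (Suc m)
            = (\<Sum>u\<in>?J. c u * U (\<lambda>i\<in>{1..d}. e' i + int (u i) - 1) m)"
          using sol e' by simp
        also have "\<dots> = (\<Sum>u\<in>?J. c u * ?V (\<lambda>i\<in>{1..d}. e' i + int (u i) - 1) m)"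
          using Suc.IH by (simp only: restrict_in_int_lattice)
        also have "\<dots> = ?V (\<lambda>i\<in>{1..d}. e' i + s i) (Suc m)"
          by (rule explicit_solution_step[symmetric])
        finally show "U e (Suc m) = ?V e (Suc m)"
          unfolding translated .
      qed
    qed
    then show ?formula
      by blast
  next
    assume ?formula
    then have formula: "U e m = ?V e m" if "e \<in> int_lattice d" for e m
      using that by blast
    show ?solution
      using explicit_solution_step[of d k s c \<Psi>]
      by (simp only: formula restrict_in_int_lattice explicit_solution_0 Suc_eq_plus1 simp_thms
          cong: ball_cong) simp
  qed
  then show ?thesis
    unfolding d_def explicit_solution_def .
qed

end
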